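(* Assume Conjecture B (stated in the context). Then there is an integer $n_0$ such that for every integer $n\ge n_0$, the sequence of iterates $(S_{4,5}^k(n))_{k\ge0}$ diverges to infinity.
   Context: For integers $t\ge 0$, $b\ge 2$, the $t$-shifted Sloane map in base $b$ is $S_{t,b}(n)=\prod_{i=0}^k (d_i+t)$, where $n=\sum_{i=0}^k d_ib^i$ is the base-$b$ expansion of $n$ ($0\le d_i\le b-1$, $d_k>0$); $S_{t,b}^k$ is its $k$-th iterate. So $S_{4,5}$ replaces each base-5 digit $d$ by the factor $d+4$ and multiplies. For a base $q$, a digit $d$ and a positive integer $n$, $\#d(n)_q$ is the number of occurrences of $d$ in the base-$q$ expansion of $n$ and $\#(n)_q$ the number of base-$q$ digits of $n$. Given $\varepsilon>0$, $n$ is $\varepsilon$-equidistributed in base $q$ if $\left|\frac{\#d(n)_q}{\#(n)_q}-\frac1q\right|<\varepsilon$ for every $d\in\{0,\dots,q-1\}$. Conjecture B: For every integer $q>1$, every finite set $F=\{p_1,\dots,p_k\}$ of primes that does not contain all primes dividing $q$, and every positive integer $a$, for every $\varepsilon>0$ there exists $N$ such that $a\prod_{i=1}^k p_i^{\alpha_i}$ (nonnegative integers $\alpha_i$) is $\varepsilon$-equidistributed in base $q$ whenever $\alpha_i\ge N$ for some $i$. *)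

theory Defs
  imports Complex_Main "HOL-Computational_Algebra.Primes"
begin

text \<open>
  Base-\<open>b\<close> digits, least significant first, without leading zeros; the expansion of \<open>0\<close> is taken
  to be the single digit \<open>0\<close>. Only bases \<open>b \<ge> 2\<close> are meaningful; the test \<open>b < 2\<close> is there for
  termination.
\<close>

fun base_digits :: "nat \<Rightarrow> nat \<Rightarrow> nat list" where
  "base_digits b n = (if b < 2 \<or> n < b then [n] else n mod b # base_digits b (n div b))"

declare base_digits.simps [simp del]

lemma horner_sum_base_digits:
  assumes "b \<ge> 2"
  shows "horner_sum id b (base_digits b n) = n"
  using assms
proof (induction b n rule: base_digits.induct)
  case (1 b n)
  then show ?case by (cases "n < b") (simp_all add: base_digits.simps [of b n])
qed

lemma base_digits_less:
  assumes "b \<ge> 2" and "d \<in> set (base_digits b n)"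
  shows "d < b"
  using assms
proof (induction b n rule: base_digits.induct)
  case (1 b n)
  then show ?case by (cases "n < b") (auto simp: base_digits.simps [of b n])
qed

lemma base_digits_not_Nil: "base_digits b n \<noteq> []"
  by (simp add: base_digits.simps [of b n])

lemma last_base_digits_pos:
  assumes "b \<ge> 2" and "n > 0"
  shows "last (base_digits b n) > 0"
  using assms
proof (induction b n rule: base_digits.induct)
  case (1 b n)
  then show ?case
    by (cases "n < b") (simp_all add: base_digits.simps [of b n] base_digits_not_Nil div_greater_zero_iff)
qed

definition sloane :: "nat \<Rightarrow> nat \<Rightarrow> nat \<Rightarrow> nat" where
  "sloane t b n = (\<Prod>d\<leftarrow>base_digits b n. d + t)"

definition equidistributed :: "real \<Rightarrow> nat \<Rightarrow> nat \<Rightarrow> bool" where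
  "equidistributed \<epsilon> q n \<longleftrightarrow>
    (\<forall>d<q. \<bar>real (count_list (base_digits q n) d) / real (length (base_digits q n)) - 1 / real q\<bar> < \<epsilon>)"

definition conjecture_B :: bool where
  "conjecture_B \<longleftrightarrow>
    (\<forall>q F a \<epsilon>. q > 1 \<longrightarrow> finite F \<longrightarrow> (\<forall>p\<in>F. prime p) \<longrightarrow> \<not> {p. prime p \<and> p dvd q} \<subseteq> F \<longrightarrow>
       a > 0 \<longrightarrow> \<epsilon> > 0 \<longrightarrow>
       (\<exists>N. \<forall>\<alpha> :: nat \<Rightarrow> nat. (\<exists>p\<in>F. \<alpha> p \<ge> N) \<longrightarrow>
          equidistributed \<epsilon> q (a * (\<Prod>p\<in>F. p ^ \<alpha> p))))"

end

theory Submission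
  imports Defs
begin

text \<open>
  Write \<open>S\<^bsub>4,5\<^esub>(n) = m \<cdot> 5\<^sup>c\<close>, where \<open>c\<close> counts the digits \<open>1\<close> of \<open>n\<close> and \<open>m\<close> has only the prime
  factors 2, 3, 7. The trailing zeros contributed by \<open>5\<^sup>c\<close> only yield factors 4, so the iterates
  need not increase at every step; instead the potential \<open>U(n) = m\<^sup>5 \<cdot> 5\<^bsup>4c\<^esup>\<close> does.
  Namely \<open>U(m \<cdot> 5\<^sup>c) = 4\<^bsup>5c\<^esup> U(m)\<close> with \<open>4\<^sup>5 > 5\<^sup>4\<close>. If some exponent of \<open>m\<close> is large,
  Conjecture B equidistributes the base-5 digits of \<open>m\<close>, and then \<open>U(m) > m\<^sup>5\<close> because
  \<open>(4 \<cdot> 6 \<cdot> 7 \<cdot> 8)\<^sup>5 \<cdot> 5\<^sup>4 > 5\<^bsup>25\<^esup>\<close>. Otherwise \<open>m\<close> is bounded, so \<open>c\<close> is large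
  whenever \<open>U(n)\<close> is, and \<open>4\<^bsup>5c\<^esup>\<close> alone exceeds \<open>m\<^sup>5 \<cdot> 5\<^bsup>4c\<^esup>\<close>.
\<close>

lemma base_digits_mult_base:
  assumes "b \<ge> 2" and "x > 0"
  shows "base_digits b (b * x) = 0 # base_digits b x"
  using assms by (simp add: base_digits.simps [of b "b * x"])

lemma base_digits_mult_power:
  assumes "b \<ge> 2" and "x > 0"
  shows "base_digits b (x * b ^ c) = replicate c 0 @ base_digits b x"
proof (induction c)
  case (Suc c)
  have "base_digits b (x * b ^ Suc c) = base_digits b (b * (x * b ^ c))"
    by (simp add: ac_simps)
  also have "\<dots> = 0 # base_digits b (x * b ^ c)"
    using assms by (intro base_digits_mult_base) auto
  finally show ?case using Suc.IH by simp
qed simp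

lemma less_power_length_base_digits:
  assumes "b \<ge> 2"
  shows "n < b ^ length (base_digits b n)"
  using assms
proof (induction b n rule: base_digits.induct)
  case (1 b n)
  show ?case
  proof (cases "n < b")
    case True
    then show ?thesis by (simp add: base_digits.simps [of b n])
  next
    case False
    with 1 have "n div b < b ^ length (base_digits b (n div b))" by simp
    then have "n < b ^ length (base_digits b (n div b)) * b"
      using 1(2) by (simp add: div_less_iff_less_mult)
    then show ?thesis
      using False 1(2) by (simp add: base_digits.simps [of b n] ac_simps)
  qed
qed

lemma prod_list_map_eq_prod_count:
  fixes f :: "nat \<Rightarrow> 'a :: comm_monoid_mult"
  assumes "set xs \<subseteq> {..<k}"
  shows "(\<Prod>x\<leftarrow>xs. f x) = (\<Prod>d<k. f d ^ count_list xs d)"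
  using assms
proof (induction xs)
  case (Cons x xs)
  have "(\<Prod>d<k. f d ^ count_list (x # xs) d)
      = (\<Prod>d<k. (if d = x then f d else 1) * f d ^ count_list xs d)"
    by (intro prod.cong) auto
  also have "\<dots> = f x * (\<Prod>d<k. f d ^ count_list xs d)"
    using Cons.prems by (simp add: prod.distrib)
  finally show ?case using Cons by simp
qed simp

lemma prod_list_ge_power:
  fixes f :: "'b \<Rightarrow> nat"
  assumes "\<And>x. x \<in> set xs \<Longrightarrow> a \<le> f x"
  shows "a ^ length xs \<le> (\<Prod>x\<leftarrow>xs. f x)"
  using assms by (induction xs) (auto intro!: mult_le_mono)

lemma lessThan_5: "{..<5::nat} = {0, 1, 2, 3, 4}"
  by auto

text \<open>The factor 5 coming from a digit 1 enters with exponent 4 instead of 5. At the next step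
  it becomes a trailing zero of weight \<open>4 ^ 5 = 1024 > 625 = 5 ^ 4\<close>, so this discount
  turns the drop from 5 to 4 into a gain.\<close>

definition weight :: "nat \<Rightarrow> nat" where
  "weight d = (if d = 1 then 5 ^ 4 else (d + 4) ^ 5)"

definition potential :: "nat \<Rightarrow> nat" where
  "potential n = (\<Prod>d\<leftarrow>base_digits 5 n. weight d)"

definition part237 :: "nat \<Rightarrow> nat" where
  "part237 n = (\<Prod>d\<leftarrow>base_digits 5 n. if d = 1 then 1 else d + 4)"

lemma weight_ge: "5 \<le> weight d"
proof (cases "d = 1")
  case False
  have "(4::nat) ^ 5 \<le> (d + 4) ^ 5" by (intro power_mono) auto
  then show ?thesis using False by (simp add: weight_def)
qed (simp add: weight_def)

text \<open>Each digit weighs at least the base. This bound carries a large starting value over to a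
  large potential.\<close>

lemma less_potential: "n < potential n"
proof -
  have "n < 5 ^ length (base_digits 5 n)" by (rule less_power_length_base_digits) simp
  also have "\<dots> \<le> potential n"
    unfolding potential_def by (intro prod_list_ge_power weight_ge)
  finally show ?thesis .
qed

lemma part237_pos: "part237 n > 0"
proof -
  have "1 ^ length (base_digits 5 n) \<le> part237 n"
    unfolding part237_def by (rule prod_list_ge_power) simp
  then show ?thesis by simp
qed

lemma sloane_eq_part237:
  "sloane 4 5 n = part237 n * 5 ^ count_list (base_digits 5 n) 1"
proof -
  have "(\<Prod>d\<leftarrow>xs. d + 4) = (\<Prod>d\<leftarrow>xs. if d = 1 then 1 else d + 4) * (5::nat) ^ count_list xs 1" for xs
    by (induction xs) auto
  then show ?thesis by (simp only: sloane_def part237_def)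
qed

lemma potential_eq_part237:
  "potential n = part237 n ^ 5 * 625 ^ count_list (base_digits 5 n) 1"
proof -
  have "(\<Prod>d\<leftarrow>xs. weight d) = (\<Prod>d\<leftarrow>xs. if d = 1 then 1 else d + 4) ^ 5 * (625::nat) ^ count_list xs 1" for xs
    by (induction xs) (auto simp: weight_def power_mult_distrib)
  then show ?thesis by (simp only: potential_def part237_def)
qed

text \<open>Carries growth of the potential back to the iterates themselves.\<close>

lemma potential_le_sloane_power: "potential n \<le> sloane 4 5 n ^ 5"
proof -
  let ?c = "count_list (base_digits 5 n) 1"
  have "(625::nat) ^ ?c \<le> (5 ^ 5) ^ ?c" by (intro power_mono) auto
  also have "\<dots> = (5 ^ ?c) ^ 5" by (simp only: power_mult [symmetric] mult.commute)
  finally show ?thesis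
    by (simp add: potential_eq_part237 sloane_eq_part237 power_mult_distrib)
qed

text \<open>The power of 5 only appends zeros to the expansion of \<open>part237 n\<close>, each of
  weight 1024.\<close>

lemma potential_sloane:
  "potential (sloane 4 5 n) = 1024 ^ count_list (base_digits 5 n) 1 * potential (part237 n)"
  unfolding sloane_eq_part237
  using part237_pos [of n]
  by (simp add: potential_def base_digits_mult_power weight_def map_replicate)

lemma part237_eq_prod_primes:
  "\<exists>\<alpha>. part237 n = (\<Prod>p\<in>{2, 3, 7::nat}. p ^ \<alpha> p)"
proof -
  let ?c = "count_list (base_digits 5 n)"
  define \<alpha> :: "nat \<Rightarrow> nat" where
    \<comment> \<open>Read off from the digit factors 4 = 2^2, 6 = 2 * 3, 7 and 8 = 2^3; the last
      branch serves p = 7.\<close>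
    "\<alpha> p = (if p = 2 then 2 * ?c 0 + ?c 2 + 3 * ?c 4 else if p = 3 then ?c 2 else ?c 3)" for p
  have "part237 n = (\<Prod>d<5. (if d = 1 then 1 else d + 4) ^ ?c d)"
    unfolding part237_def
    by (rule prod_list_map_eq_prod_count) (auto intro: base_digits_less [of 5])
  also have "\<dots> = (2 ^ 2) ^ ?c 0 * (2 * 3) ^ ?c 2 * 7 ^ ?c 3 * (2 ^ 3) ^ ?c 4"
    by (simp add: lessThan_5)
  also have "\<dots> = (\<Prod>p\<in>{2, 3, 7::nat}. p ^ \<alpha> p)"
    unfolding \<alpha>_def power_mult_distrib power_mult [symmetric] by (simp add: power_add ac_simps)
  finally show ?thesis by blast
qed

lemma power5_less_potential_if_equidistributed:
  assumes "equidistributed (1 / 100) 5 m"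
  shows "m ^ 5 < potential m"
proof -
  let ?c = "count_list (base_digits 5 m)" and ?L = "length (base_digits 5 m)"
  have L: "?L > 0" by (simp add: base_digits_not_Nil)
  have count_ge: "19 * ?L \<le> 100 * ?c d" if "d < 5" for d
  proof -
    have "\<bar>real (?c d) / real ?L - 1 / 5\<bar> < 1 / 100"
      using assms that by (auto simp: equidistributed_def)
    then have "real (?c d) / real ?L > 19 / 100" by linarith
    then have "100 * real (?c d) > 19 * real ?L" using L by (simp add: field_simps)
    then show ?thesis by linarith
  qed
  have potential_eq: "potential m = (\<Prod>d<5. weight d ^ ?c d)"
    unfolding potential_def
    by (rule prod_list_map_eq_prod_count) (auto intro: base_digits_less [of 5])
  \<comment> \<open>Comparing 100th powers keeps all exponents integral, since the frequency bound
    is 19/100.\<close>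
  have "m ^ 500 < (5 ^ ?L) ^ 500"
    using less_power_length_base_digits [of 5 m] by (intro power_strict_mono) auto
  also have "\<dots> = (5 ^ 500) ^ ?L" by (simp only: power_mult [symmetric] mult.commute)
  \<comment> \<open>The numerical core: 5^500 is below the 19th power of 5^4 * (4 * 6 * 7 * 8)^5. An
    18th power would be too small, so the tolerance 1/100 is fairly tight.\<close>
  also have "\<dots> \<le> ((\<Prod>d<5. weight d) ^ 19) ^ ?L"
    by (intro power_mono) (simp_all add: lessThan_5 weight_def)
  also have "\<dots> = (\<Prod>d<5. weight d ^ (19 * ?L))"
    by (simp only: power_mult [symmetric] prod_power_distrib)
  also have "\<dots> \<le> (\<Prod>d<5. weight d ^ (100 * ?c d))"
  proof (rule prod_mono, intro conjI power_increasing)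
    fix d assume "d \<in> {..<5::nat}"
    then show "19 * ?L \<le> 100 * ?c d" using count_ge by simp
    show "1 \<le> weight d" using weight_ge [of d] by simp
  qed simp
  also have "\<dots> = potential m ^ 100"
    unfolding potential_eq by (simp only: power_mult [symmetric] prod_power_distrib mult.commute)
  finally have "(m ^ 5) ^ 100 < potential m ^ 100" by (simp add: power_mult [symmetric])
  then show ?thesis by (rule power_less_imp_less_base) simp
qed

lemma potential_less_potential_sloane:
  assumes "conjecture_B"
  shows "\<exists>W. \<forall>n. W \<le> potential n \<longrightarrow> potential n < potential (sloane 4 5 n)"
proof -
  have primes: "\<forall>p\<in>{2, 3, 7::nat}. prime p"
    by (auto simp: prime_nat_iff' atLeastLessThan_nat_numeral)
  have "prime (5::nat)" by (simp add: prime_nat_iff' atLeastLessThan_nat_numeral)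
  then have "5 \<in> {p. prime p \<and> p dvd (5::nat)} - {2, 3, 7}" by simp
  then have "\<not> {p. prime p \<and> p dvd (5::nat)} \<subseteq> {2, 3, 7}" by blast
  then have "\<exists>N. \<forall>\<alpha> :: nat \<Rightarrow> nat. (\<exists>p\<in>{2, 3, 7}. \<alpha> p \<ge> N) \<longrightarrow>
      equidistributed (1 / 100) 5 (1 * (\<Prod>p\<in>{2, 3, 7}. p ^ \<alpha> p))"
    by (intro assms [unfolded conjecture_B_def, THEN spec, THEN spec, THEN spec, THEN spec,
          THEN mp, THEN mp, THEN mp, THEN mp, THEN mp, THEN mp] primes) simp_all
  then obtain N where N: "\<And>\<alpha> :: nat \<Rightarrow> nat. \<exists>p\<in>{2, 3, 7}. \<alpha> p \<ge> N \<Longrightarrow>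
      equidistributed (1 / 100) 5 (1 * (\<Prod>p\<in>{2, 3, 7}. p ^ \<alpha> p))"
    by blast
  define M :: nat where "M = (\<Prod>p\<in>{2, 3, 7}. p ^ N)"
  \<comment> \<open>\<open>C\<close> digits 1 gain enough, at a ratio of 1024/625 each, to outweigh
    any \<open>part237 n\<close> bounded by \<open>M\<close>.\<close>
  obtain C where C: "real (M ^ 5) < (1024 / 625) ^ C"
    using real_arch_pow [of "1024 / 625" "real (M ^ 5)"] by auto
  show ?thesis
  proof (intro exI allI impI)
    \<comment> \<open>This threshold forces at least \<open>C\<close> digits 1 as soon as
      \<open>part237 n\<close> is at most \<open>M\<close>.\<close>
    fix n assume large: "M ^ 5 * 625 ^ C \<le> potential n"
    let ?m = "part237 n" and ?c = "count_list (base_digits 5 n) 1"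
    obtain \<alpha> where \<alpha>: "?m = (\<Prod>p\<in>{2, 3, 7::nat}. p ^ \<alpha> p)"
      using part237_eq_prod_primes by blast
    show "potential n < potential (sloane 4 5 n)"
    proof (cases "\<exists>p\<in>{2, 3, 7}. \<alpha> p \<ge> N")
      case True
      then have "equidistributed (1 / 100) 5 ?m" using N [of \<alpha>] \<alpha> by simp
      then have "?m ^ 5 < potential ?m" by (rule power5_less_potential_if_equidistributed)
      \<comment> \<open>Only a weak inequality, as \<open>?c\<close> may be 0; strictness comes from
        the other factor.\<close>
      moreover have "(625::nat) ^ ?c \<le> 1024 ^ ?c" by (intro power_mono) auto
      ultimately show ?thesis
        unfolding potential_eq_part237 [of n] potential_sloane mult.commute [of "1024 ^ _"]
        by (intro mult_less_le_imp_less) auto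
    next
      case False
      then have "?m \<le> M"
        unfolding \<alpha> M_def by (intro prod_mono conjI power_increasing) auto
      then have m5: "?m ^ 5 \<le> M ^ 5" by (rule power_mono) simp
      have "M > 0" by (simp add: M_def)
      have "M ^ 5 * 625 ^ C \<le> M ^ 5 * 625 ^ ?c"
        using large m5 unfolding potential_eq_part237 by (meson le_trans mult_le_mono1)
      then have "C \<le> ?c" using \<open>M > 0\<close> by simp
      then have "(1024 / 625 :: real) ^ C \<le> (1024 / 625) ^ ?c" by (intro power_increasing) auto
      with C have "real (M ^ 5) < 1024 ^ ?c / 625 ^ ?c" by (simp add: power_divide)
      then have "real (M ^ 5 * 625 ^ ?c) < real (1024 ^ ?c)" by (simp add: field_simps)
      then have "M ^ 5 * 625 ^ ?c < 1024 ^ ?c" by (simp only: of_nat_less_iff)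
      moreover have "1 \<le> potential ?m" using less_potential [of ?m] by simp
      ultimately have "M ^ 5 * 625 ^ ?c < 1024 ^ ?c * potential ?m"
        by (metis less_le_trans mult.right_neutral mult_le_mono2)
      then show ?thesis
        using m5 unfolding potential_eq_part237 [of n] potential_sloane
        by (meson le_less_trans mult_le_mono1)
    qed
  qed
qed

theorem theorem17:
  assumes "conjecture_B"
  shows "\<exists>n\<^sub>0 :: nat. \<forall>n\<ge>n\<^sub>0. filterlim (\<lambda>k. (sloane 4 5 ^^ k) n) at_top sequentially"
proof -
  obtain W where W: "\<And>n. W \<le> potential n \<Longrightarrow> potential n < potential (sloane 4 5 n)"
    using potential_less_potential_sloane [OF assms] by blast
  show ?thesis
  proof (intro exI allI impI)
    \<comment> \<open>The threshold for the potential also serves for n, because n is below its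
      potential.\<close>
    fix n assume "W \<le> n"
    have growth: "W + k \<le> potential ((sloane 4 5 ^^ k) n)" for k
    proof (induction k)
      case 0
      then show ?case using \<open>W \<le> n\<close> less_potential [of n] by simp
    next
      case (Suc k)
      then show ?case using W [of "(sloane 4 5 ^^ k) n"] by simp
    qed
    \<comment> \<open>The potential of an iterate bounds the fifth power of the next one, hence the
      shift to \<open>Suc k\<close>.\<close>
    have le_power: "k \<le> ((sloane 4 5 ^^ Suc k) n) ^ 5" for k
      using growth [of k] potential_le_sloane_power [of "(sloane 4 5 ^^ k) n"] by simp
    have "Z \<le> (sloane 4 5 ^^ Suc k) n" if "Z ^ 5 \<le> k" for Z k
    proof -
      have "Z ^ 5 \<le> ((sloane 4 5 ^^ Suc k) n) ^ 5" using that le_power [of k] by (rule le_trans)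
      then show ?thesis by (rule power_mono_iff [THEN iffD1, rotated -1]) simp_all
    qed
    then have "filterlim (\<lambda>k. (sloane 4 5 ^^ Suc k) n) at_top sequentially"
      unfolding filterlim_at_top eventually_sequentially by blast
    then show "filterlim (\<lambda>k. (sloane 4 5 ^^ k) n) at_top sequentially"
      by (rule filterlim_sequentially_Suc [THEN iffD1])
  qed
qed

end
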